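(* Let $M\in\mathbb{R}^{m\times n}$, let $W\in\{0,1\}^{m\times n}$, let $\mathcal{C}_u\subseteq\mathbb{R}^{m\times r}$ and $\mathcal{C}_v\subseteq\mathbb{R}^{n\times r}$ be closed convex sets, let $R_u$ and $R_v$ be convex regularization functions on $\mathbb{R}^{m\times r}$ and $\mathbb{R}^{n\times r}$, and consider the robust matrix factorization problem $$\min_{U\in\mathcal{C}_u,\,V\in\mathcal{C}_v} F(U,V),\qquad F(U,V)=\|W\odot(M-UV^T)\|_1+R_u(U)+R_v(V).$$ Let $\{(U_k,V_k)\}\subset\mathcal{C}_u\times\mathcal{C}_v$ be generated by $(U_{k+1},V_{k+1})=(U_k,V_k)+(\Delta U_k,\Delta V_k)$, where $(\Delta U_k,\Delta V_k)$ is the minimizer, subject to $U_k+\Delta U\in\mathcal{C}_u$ and $V_k+\Delta V\in\mathcal{C}_v$, of $$G_k(\Delta U,\Delta V)=\|W\odot(M-U_kV_k^T-\Delta U V_k^T-U_k\Delta V^T)\|_1+R_u(U_k+\Delta U)+R_v(V_k+\Delta V)+\frac{\rho_u}{2}\|\Delta U\|_F^2+\frac{\rho_v}{2}\|\Delta V\|_F^2,$$ with the positive parameters $\rho_u,\rho_v$ chosen according to either of the two rules (RMF-GMMM or RMF-LMMM) described in the context. Then the sequence $\{F(U_k,V_k)\}$ has sufficient descent, i.e. there exists a constant $\alpha>0$ such that $$F(U_k,V_k)-F(U_{k+1},V_{k+1})\ge\alpha\left(\|U_k-U_{k+1}\|_F^2+\|V_k-V_{k+1}\|_F^2\right)\qquad\text{for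 all }k,$$ and the sequence $\{(U_k,V_k)\}$ converges to stationary points, i.e. any limit point of $\{(U_k,V_k)\}$ is a stationary point of $F$ over $\mathcal{C}_u\times\mathcal{C}_v$.
   Context: $\|\cdot\|_1$ is the sum of the absolute values of the entries of a matrix, $\|\cdot\|_F$ is the Frobenius norm, and $\odot$ is the entry-wise (Hadamard) product. An entry $W_{ij}=1$ means that $M_{ij}$ is observed, and $W_{ij}=0$ that it is missing. Let $\#W_{(i,.)}$ be the number of ones in the $i$-th row of $W$ and $\#W_{(.,j)}$ the number of ones in the $j$-th column of $W$. Fix any $\epsilon>0$ and set $$\bar\rho_u=\max\{\#W_{(i,.)}: i=1,\ldots,m\}+\epsilon,\qquad \bar\rho_v=\max\{\#W_{(.,j)}: j=1,\ldots,n\}+\epsilon.$$ The two rules for choosing $\rho_u,\rho_v$ are: (RMF-GMMM) $\rho_u=\bar\rho_u$ and $\rho_v=\bar\rho_v$ throughout all iterations. (RMF-LMMM) $\rho_u$ and $\rho_v$ (which may depend on $k$) are initialized with relatively small positive values and then increased gradually by a line search which ensures, at every iteration $k$, the local majorization condition $F(U_k+\Delta U_k,V_k+\Delta V_k)\le G_k(\Delta U_k,\Delta V_k)$ at the minimizer $(\Delta U_k,\Delta V_k)$ of $G_k$; $\rho_u$ and $\rho_v$ eventually reach the upper bounds $\bar\rho_u$ and $\bar\rho_v$. Directional derivative: for a function $h$ and a direction $\mathbf{d}$ feasible at $\mathbf{x}$ (i.e. $\mathbf{x}+\mathbf{d}\in\mathcal{C}$, where $\mathcal{C}$ is the constraint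 set, here $\mathcal{C}=\mathcal{C}_u\times\mathcal{C}_v$ and $\mathbf{x}=(U,V)$), $\nabla h(\mathbf{x};\mathbf{d})=\liminf_{\theta\downarrow0}\frac{h(\mathbf{x}+\theta\mathbf{d})-h(\mathbf{x})}{\theta}$. A point $\mathbf{x}^*$ is a stationary point of $h$ if $\nabla h(\mathbf{x}^*;\mathbf{d})\ge0$ for all $\mathbf{d}$ such that $\mathbf{x}^*+\mathbf{d}\in\mathcal{C}$. *)

theory Defs
  imports "HOL-Analysis.Analysis"
begin

text \<open>
  Multiplication on the vector type is component-wise, so on matrices it is the
  Hadamard product (the matrix product is \<open>**\<close>).  Likewise, the norm of a matrix is its
  Frobenius norm.
\<close>

abbreviation hadamard :: "real^'n^'m \<Rightarrow> real^'n^'m \<Rightarrow> real^'n^'m"  (infixl "\<odot>" 70) where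
  "A \<odot> B \<equiv> A * B"

lemma hadamard_nth: "(A \<odot> B) $ i $ j = A $ i $ j * B $ i $ j"
  by simp

lemma norm_matrix_frobenius:
  fixes A :: "real^'n^'m"
  shows "norm A = sqrt (\<Sum>i\<in>UNIV. \<Sum>j\<in>UNIV. (A $ i $ j)\<^sup>2)"
  by (simp add: norm_vec_def L2_set_def sum_nonneg)

definition l1_norm :: "real^'n^'m \<Rightarrow> real" where
  "l1_norm A = (\<Sum>i\<in>UNIV. \<Sum>j\<in>UNIV. \<bar>A $ i $ j\<bar>)"

definition rmf_objective ::
  "real^'n^'m \<Rightarrow> real^'n^'m \<Rightarrow> (real^'r^'m \<Rightarrow> real) \<Rightarrow> (real^'r^'n \<Rightarrow> real)
    \<Rightarrow> (real^'r^'m) \<times> (real^'r^'n) \<Rightarrow> real" where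
  "rmf_objective M W Ru Rv = (\<lambda>(U, V).
     l1_norm (W \<odot> (M - U ** transpose V)) + Ru U + Rv V)"

definition rmf_surrogate ::
  "real^'n^'m \<Rightarrow> real^'n^'m \<Rightarrow> (real^'r^'m \<Rightarrow> real) \<Rightarrow> (real^'r^'n \<Rightarrow> real)
    \<Rightarrow> real \<Rightarrow> real \<Rightarrow> real^'r^'m \<Rightarrow> real^'r^'n
    \<Rightarrow> (real^'r^'m) \<times> (real^'r^'n) \<Rightarrow> real" where
  "rmf_surrogate M W Ru Rv \<rho>u \<rho>v U V = (\<lambda>(DU, DV).
     l1_norm (W \<odot> (M - U ** transpose V - DU ** transpose V - U ** transpose DV))
     + Ru (U + DU) + Rv (V + DV)
     + \<rho>u / 2 * (norm DU)\<^sup>2 + \<rho>v / 2 * (norm DV)\<^sup>2)"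

definition rho_bar_u :: "real^'n^'m \<Rightarrow> real \<Rightarrow> real" where
  "rho_bar_u W \<epsilon> = real (Max (range (\<lambda>i. card {j. W $ i $ j = 1}))) + \<epsilon>"

definition rho_bar_v :: "real^'n^'m \<Rightarrow> real \<Rightarrow> real" where
  "rho_bar_v W \<epsilon> = real (Max (range (\<lambda>j. card {i. W $ i $ j = 1}))) + \<epsilon>"

definition rmf_iterates ::
  "real^'n^'m \<Rightarrow> real^'n^'m \<Rightarrow> (real^'r^'m \<Rightarrow> real) \<Rightarrow> (real^'r^'n \<Rightarrow> real)
    \<Rightarrow> (real^'r^'m) set \<Rightarrow> (real^'r^'n) set \<Rightarrow> (nat \<Rightarrow> real) \<Rightarrow> (nat \<Rightarrow> real)
    \<Rightarrow> (nat \<Rightarrow> real^'r^'m) \<Rightarrow> (nat \<Rightarrow> real^'r^'n)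
    \<Rightarrow> (nat \<Rightarrow> real^'r^'m) \<Rightarrow> (nat \<Rightarrow> real^'r^'n) \<Rightarrow> bool" where
  "rmf_iterates M W Ru Rv Cu Cv \<rho>u \<rho>v U V DU DV \<longleftrightarrow>
     (\<forall>k. U k \<in> Cu \<and> V k \<in> Cv
        \<and> is_arg_min (rmf_surrogate M W Ru Rv (\<rho>u k) (\<rho>v k) (U k) (V k))
             (\<lambda>(A, B). U k + A \<in> Cu \<and> V k + B \<in> Cv) (DU k, DV k)
        \<and> U (Suc k) = U k + DU k \<and> V (Suc k) = V k + DV k)"

definition gmmm_rule ::
  "real^'n^'m \<Rightarrow> real \<Rightarrow> (nat \<Rightarrow> real) \<Rightarrow> (nat \<Rightarrow> real) \<Rightarrow> bool" where
  "gmmm_rule W \<epsilon> \<rho>u \<rho>v \<longleftrightarrow> (\<forall>k. \<rho>u k = rho_bar_u W \<epsilon> \<and> \<rho>v k = rho_bar_v W \<epsilon>)"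

text \<open>
  The local rule is stated for the parameter values accepted by the line search in each
  iteration.  The last conjunct is the local majorization condition at the minimizer
  \<open>(DU k, DV k)\<close> of the surrogate; that the values never exceed the two upper bounds follows
  from monotonicity.
\<close>

definition lmmm_rule ::
  "real^'n^'m \<Rightarrow> real^'n^'m \<Rightarrow> (real^'r^'m \<Rightarrow> real) \<Rightarrow> (real^'r^'n \<Rightarrow> real) \<Rightarrow> real
    \<Rightarrow> (nat \<Rightarrow> real) \<Rightarrow> (nat \<Rightarrow> real)
    \<Rightarrow> (nat \<Rightarrow> real^'r^'m) \<Rightarrow> (nat \<Rightarrow> real^'r^'n)
    \<Rightarrow> (nat \<Rightarrow> real^'r^'m) \<Rightarrow> (nat \<Rightarrow> real^'r^'n) \<Rightarrow> bool" where
  "lmmm_rule M W Ru Rv \<epsilon> \<rho>u \<rho>v U V DU DV \<longleftrightarrow>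
     0 < \<rho>u 0 \<and> 0 < \<rho>v 0 \<and> incseq \<rho>u \<and> incseq \<rho>v
     \<and> (\<forall>\<^sub>F k in sequentially. \<rho>u k = rho_bar_u W \<epsilon>)
     \<and> (\<forall>\<^sub>F k in sequentially. \<rho>v k = rho_bar_v W \<epsilon>)
     \<and> (\<forall>k. rmf_objective M W Ru Rv (U k + DU k, V k + DV k)
            \<le> rmf_surrogate M W Ru Rv (\<rho>u k) (\<rho>v k) (U k) (V k) (DU k, DV k))"

text \<open>The lower limit of the difference quotients is taken in the extended reals, where it
  always exists.\<close>

definition dir_deriv :: "('a::real_normed_vector \<Rightarrow> real) \<Rightarrow> 'a \<Rightarrow> 'a \<Rightarrow> ereal" where
  "dir_deriv h x d = Liminf (at_right 0) (\<lambda>\<theta>. ereal ((h (x + \<theta> *\<^sub>R d) - h x) / \<theta>))"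

definition stationary_point_over ::
  "('a::real_normed_vector \<Rightarrow> real) \<Rightarrow> 'a set \<Rightarrow> 'a \<Rightarrow> bool" where
  "stationary_point_over h C x \<longleftrightarrow> x \<in> C \<and> (\<forall>d. x + d \<in> C \<longrightarrow> 0 \<le> dir_deriv h x d)"

definition seq_limit_point :: "(nat \<Rightarrow> 'a::topological_space) \<Rightarrow> 'a \<Rightarrow> bool" where
  "seq_limit_point X x \<longleftrightarrow> (\<exists>s. strict_mono s \<and> (X \<circ> s) \<longlonglongrightarrow> x)"

end

theory Submission
  imports Defs
begin

text \<open>
  The objective and the surrogate centred at \<open>(U, V)\<close> agree at \<open>(U, V)\<close>, and they differ elsewhere
  only by the bilinear term \<open>\<Delta>U \<Delta>V\<^sup>T\<close> and the quadratic penalty, hence by \<open>O(\<theta>\<^sup>2)\<close> along a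
  direction scaled by \<open>\<theta>\<close>. Majorization and strong convexity of the surrogate give the descent.
  At a limit point, passing to the limit in the minimality of the steps shows that the zero step
  minimizes the limiting surrogate, and the \<open>O(\<theta>\<^sup>2)\<close> error is invisible to directional derivatives.
\<close>

section \<open>Algebra and continuity of the l1 norm, the Hadamard product and
  \<open>A ** transpose B\<close>\<close>

lemma l1_norm_triangle: "l1_norm (A + B) \<le> l1_norm A + l1_norm B"
  unfolding l1_norm_def by (auto simp: sum.distrib [symmetric] intro!: sum_mono)

lemma l1_norm_scaleR: "l1_norm (c *\<^sub>R A) = \<bar>c\<bar> * l1_norm A"
  by (simp add: l1_norm_def abs_mult sum_distrib_left)

lemma l1_norm_minus: "l1_norm (- A) = l1_norm A"
  by (simp add: l1_norm_def)

lemma tendsto_l1_norm: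
  "(f \<longlongrightarrow> A) F \<Longrightarrow> ((\<lambda>x. l1_norm (f x)) \<longlongrightarrow> l1_norm A) F"
  unfolding l1_norm_def by (intro tendsto_intros)

lemma tendsto_hadamard:
  fixes f g :: "'a \<Rightarrow> real^'n^'m"
  assumes "(f \<longlongrightarrow> A) F" "(g \<longlongrightarrow> B) F"
  shows "((\<lambda>x. f x \<odot> g x) \<longlongrightarrow> A \<odot> B) F"
  by (intro vec_tendstoI) (auto intro!: tendsto_intros assms)

lemma matrix_mult_transpose_nth:
  fixes A :: "real^'r^'m" and B :: "real^'r^'n"
  shows "(A ** transpose B) $ i $ j = A $ i \<bullet> B $ j"
  by (simp add: matrix_matrix_mult_def transpose_def inner_vec_def)

lemma tendsto_matrix_mult_transpose:
  fixes f :: "'a \<Rightarrow> real^'r^'m" and g :: "'a \<Rightarrow> real^'r^'n"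
  assumes "(f \<longlongrightarrow> A) F" "(g \<longlongrightarrow> B) F"
  shows "((\<lambda>x. f x ** transpose (g x)) \<longlongrightarrow> A ** transpose B) F"
  by (intro vec_tendstoI) (auto simp: matrix_mult_transpose_nth intro!: tendsto_intros assms)

lemma matrix_add_mult_transpose_add:
  fixes U A :: "real^'r^'m" and V B :: "real^'r^'n"
  shows "(U + A) ** transpose (V + B)
    = U ** transpose V + A ** transpose V + U ** transpose B + A ** transpose B"
  by (simp add: vec_eq_iff matrix_mult_transpose_nth inner_add_left inner_add_right)

lemma matrix_scaleR_mult_transpose:
  fixes A :: "real^'r^'m" and B :: "real^'r^'n"
  shows "(c *\<^sub>R A) ** transpose (d *\<^sub>R B) = (c * d) *\<^sub>R (A ** transpose B)"
  by (simp add: vec_eq_iff matrix_mult_transpose_nth)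

section \<open>Counting bound for the masked bilinear term\<close>

lemma norm_vec_squared: "(norm (A :: real^'r^'m))\<^sup>2 = (\<Sum>i\<in>UNIV. (norm (A $ i))\<^sup>2)"
  by (simp add: norm_vec_def L2_set_def sum_nonneg)

text \<open>Cauchy-Schwarz and the arithmetic-geometric mean inequality split each observed entry
  into half the squared norms of row i of \<open>A\<close> and row j of \<open>B\<close>. Summation
  counts the first once per one in row i of \<open>W\<close> and the second once per one in column
  j, which explains the two bounds.\<close>

lemma l1_norm_hadamard_mult_transpose_le:
  fixes W :: "real^'n^'m" and A :: "real^'r^'m" and B :: "real^'r^'n"
  assumes W: "\<And>i j. W $ i $ j \<in> {0, 1}" and "\<epsilon> \<ge> 0"
  shows "l1_norm (W \<odot> (A ** transpose B))
    \<le> rho_bar_u W \<epsilon> / 2 * (norm A)\<^sup>2 + rho_bar_v W \<epsilon> / 2 * (norm B)\<^sup>2"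
proof -
  \<comment> \<open>In this form a row or column sum of \<open>W\<close> simplifies to a
    cardinality.\<close>
  have W01: "W $ i $ j = of_bool (W $ i $ j = 1)" for i j
    using W [of i j] by auto
  have row: "(\<Sum>j\<in>UNIV. W $ i $ j) = card {j. W $ i $ j = 1}" for i
    by (subst W01) simp
  have col: "(\<Sum>i\<in>UNIV. W $ i $ j) = card {i. W $ i $ j = 1}" for j
    by (subst W01) simp
  have row_le: "(\<Sum>j\<in>UNIV. W $ i $ j) \<le> rho_bar_u W \<epsilon>" for i
    using assms(2) Max_ge [of "range (\<lambda>i. card {j. W $ i $ j = 1})" "card {j. W $ i $ j = 1}"]
    unfolding row rho_bar_u_def by (simp add: add_increasing2)
  have col_le: "(\<Sum>i\<in>UNIV. W $ i $ j) \<le> rho_bar_v W \<epsilon>" for j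
    using assms(2) Max_ge [of "range (\<lambda>j. card {i. W $ i $ j = 1})" "card {i. W $ i $ j = 1}"]
    unfolding col rho_bar_v_def by (simp add: add_increasing2)
  have entry: "\<bar>W $ i $ j * (A $ i \<bullet> B $ j)\<bar>
      \<le> W $ i $ j * (norm (A $ i))\<^sup>2 / 2 + W $ i $ j * (norm (B $ j))\<^sup>2 / 2" for i j
  proof -
    have "\<bar>A $ i \<bullet> B $ j\<bar> \<le> norm (A $ i) * norm (B $ j)"
      by (rule Cauchy_Schwarz_ineq2)
    also have "\<dots> \<le> (norm (A $ i))\<^sup>2 / 2 + (norm (B $ j))\<^sup>2 / 2"
      using sum_squares_bound [of "norm (A $ i)" "norm (B $ j)"] by simp
    finally show ?thesis
      using W [of i j] by auto
  qed
  have "l1_norm (W \<odot> (A ** transpose B))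
      \<le> (\<Sum>i\<in>UNIV. \<Sum>j\<in>UNIV. W $ i $ j * (norm (A $ i))\<^sup>2 / 2 + W $ i $ j * (norm (B $ j))\<^sup>2 / 2)"
    unfolding l1_norm_def by (intro sum_mono) (simp add: matrix_mult_transpose_nth entry)
  also have "\<dots> = (\<Sum>i\<in>UNIV. \<Sum>j\<in>UNIV. W $ i $ j * (norm (A $ i))\<^sup>2 / 2)
      + (\<Sum>i\<in>UNIV. \<Sum>j\<in>UNIV. W $ i $ j * (norm (B $ j))\<^sup>2 / 2)"
    by (simp add: sum.distrib)
  \<comment> \<open>The norm of \<open>B $ j\<close> factors out only if the inner sum runs over
    i.\<close>
  also have "(\<Sum>i\<in>UNIV. \<Sum>j\<in>UNIV. W $ i $ j * (norm (B $ j))\<^sup>2 / 2)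
      = (\<Sum>j\<in>UNIV. \<Sum>i\<in>UNIV. W $ i $ j * (norm (B $ j))\<^sup>2 / 2)"
    by (rule sum.swap)
  also have "(\<Sum>i\<in>UNIV. \<Sum>j\<in>UNIV. W $ i $ j * (norm (A $ i))\<^sup>2 / 2)
      = (\<Sum>i\<in>UNIV. (\<Sum>j\<in>UNIV. W $ i $ j) * ((norm (A $ i))\<^sup>2 / 2))"
    by (simp add: sum_distrib_right sum_divide_distrib)
  also have "(\<Sum>j\<in>UNIV. \<Sum>i\<in>UNIV. W $ i $ j * (norm (B $ j))\<^sup>2 / 2)
      = (\<Sum>j\<in>UNIV. (\<Sum>i\<in>UNIV. W $ i $ j) * ((norm (B $ j))\<^sup>2 / 2))"
    by (simp add: sum_distrib_right sum_divide_distrib)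
  also have "(\<Sum>i\<in>UNIV. (\<Sum>j\<in>UNIV. W $ i $ j) * ((norm (A $ i))\<^sup>2 / 2))
      + (\<Sum>j\<in>UNIV. (\<Sum>i\<in>UNIV. W $ i $ j) * ((norm (B $ j))\<^sup>2 / 2))
      \<le> (\<Sum>i\<in>UNIV. rho_bar_u W \<epsilon> * ((norm (A $ i))\<^sup>2 / 2))
        + (\<Sum>j\<in>UNIV. rho_bar_v W \<epsilon> * ((norm (B $ j))\<^sup>2 / 2))"
    by (intro add_mono sum_mono mult_right_mono row_le col_le) auto
  also have "\<dots> = rho_bar_u W \<epsilon> / 2 * (norm A)\<^sup>2 + rho_bar_v W \<epsilon> / 2 * (norm B)\<^sup>2"
    by (simp add: norm_vec_squared sum_distrib_left)
  finally show ?thesis .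
qed

section \<open>Comparison of surrogate and objective; decrease at the surrogate's minimizer\<close>

lemma rmf_surrogate_zero: "rmf_surrogate M W Ru Rv \<rho>u \<rho>v U V (0, 0) = rmf_objective M W Ru Rv (U, V)"
  by (simp add: rmf_surrogate_def rmf_objective_def l1_norm_def matrix_mult_transpose_nth)

text \<open>The linearized residual is the true one plus the masked bilinear term. The triangle
  inequality, used in either direction, turns this into an upper and a lower bound for the
  objective.\<close>

lemma residual_add:
  fixes W M :: "real^'n^'m" and U A :: "real^'r^'m" and V B :: "real^'r^'n"
  shows "W \<odot> (M - U ** transpose V - A ** transpose V - U ** transpose B)
    = W \<odot> (M - (U + A) ** transpose (V + B)) + W \<odot> (A ** transpose B)"
  by (simp add: matrix_add_mult_transpose_add algebra_simps)

lemma rmf_objective_le_surrogate: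
  assumes "\<And>i j. W $ i $ j \<in> {0, 1}" and "\<epsilon> \<ge> 0"
  shows "rmf_objective M W Ru Rv (U + A, V + B)
    \<le> rmf_surrogate M W Ru Rv (rho_bar_u W \<epsilon>) (rho_bar_v W \<epsilon>) U V (A, B)"
proof -
  let ?L = "W \<odot> (M - U ** transpose V - A ** transpose V - U ** transpose B)"
  have "l1_norm (W \<odot> (M - (U + A) ** transpose (V + B)))
      = l1_norm (?L + - (W \<odot> (A ** transpose B)))"
    by (simp add: residual_add)
  also have "\<dots> \<le> l1_norm ?L + l1_norm (W \<odot> (A ** transpose B))"
    using l1_norm_triangle [of ?L "- (W \<odot> (A ** transpose B))"] by (simp only: l1_norm_minus)
  finally show ?thesis
    using l1_norm_hadamard_mult_transpose_le [OF assms, of A B]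
    by (simp add: rmf_objective_def rmf_surrogate_def)
qed

text \<open>Converse to majorization: the error in parentheses is homogeneous of degree two in
  \<open>(A, B)\<close>, hence negligible to first order along a scaled direction.\<close>

lemma rmf_surrogate_le_objective:
  "rmf_surrogate M W Ru Rv \<rho>u \<rho>v U V (A, B)
    \<le> rmf_objective M W Ru Rv (U + A, V + B)
      + (l1_norm (W \<odot> (A ** transpose B)) + \<rho>u / 2 * (norm A)\<^sup>2 + \<rho>v / 2 * (norm B)\<^sup>2)"
  using l1_norm_triangle [of "W \<odot> (M - (U + A) ** transpose (V + B))" "W \<odot> (A ** transpose B)"]
  by (simp add: rmf_objective_def rmf_surrogate_def residual_add)

text \<open>The shrunken step is a convex combination of \<open>(A, B)\<close> and the zero step,
  where the surrogate equals the objective. The l1 part and the regularizers are convex; the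
  quadratic penalty supplies the extra term of strong convexity.\<close>

lemma rmf_surrogate_shrink:
  assumes "convex_on UNIV Ru" "convex_on UNIV Rv" and t: "0 \<le> t" "t \<le> 1"
  shows "rmf_surrogate M W Ru Rv \<rho>u \<rho>v U V ((1 - t) *\<^sub>R A, (1 - t) *\<^sub>R B)
    \<le> (1 - t) * rmf_surrogate M W Ru Rv \<rho>u \<rho>v U V (A, B) + t * rmf_objective M W Ru Rv (U, V)
      - t * (1 - t) * (\<rho>u / 2 * (norm A)\<^sup>2 + \<rho>v / 2 * (norm B)\<^sup>2)"
proof -
  let ?L = "W \<odot> (M - U ** transpose V - A ** transpose V - U ** transpose B)"
  let ?R = "W \<odot> (M - U ** transpose V)"
  have "W \<odot> (M - U ** transpose V - ((1 - t) *\<^sub>R A) ** transpose V - U ** transpose ((1 - t) *\<^sub>R B))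
      = (1 - t) *\<^sub>R ?L + t *\<^sub>R ?R"
    by (simp add: vec_eq_iff matrix_mult_transpose_nth algebra_simps)
  then have l1: "l1_norm (W \<odot> (M - U ** transpose V - ((1 - t) *\<^sub>R A) ** transpose V
      - U ** transpose ((1 - t) *\<^sub>R B))) \<le> (1 - t) * l1_norm ?L + t * l1_norm ?R"
    using l1_norm_triangle [of "(1 - t) *\<^sub>R ?L" "t *\<^sub>R ?R"] t by (simp add: l1_norm_scaleR)
  have "(1 - t) *\<^sub>R (U + A) + t *\<^sub>R U = U + (1 - t) *\<^sub>R A"
    by (simp add: algebra_simps)
  with convex_onD [OF assms(1), of t "U + A" U]
  have Ru: "Ru (U + (1 - t) *\<^sub>R A) \<le> (1 - t) * Ru (U + A) + t * Ru U"
    using t by simp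
  have "(1 - t) *\<^sub>R (V + B) + t *\<^sub>R V = V + (1 - t) *\<^sub>R B"
    by (simp add: algebra_simps)
  with convex_onD [OF assms(2), of t "V + B" V]
  have Rv: "Rv (V + (1 - t) *\<^sub>R B) \<le> (1 - t) * Rv (V + B) + t * Rv V"
    using t by simp
  \<comment> \<open>The square of 1 - t equals (1 - t) - t * (1 - t).\<close>
  have "\<rho>u / 2 * (norm ((1 - t) *\<^sub>R A))\<^sup>2 + \<rho>v / 2 * (norm ((1 - t) *\<^sub>R B))\<^sup>2
      = (1 - t) * (\<rho>u / 2 * (norm A)\<^sup>2 + \<rho>v / 2 * (norm B)\<^sup>2)
        - t * (1 - t) * (\<rho>u / 2 * (norm A)\<^sup>2 + \<rho>v / 2 * (norm B)\<^sup>2)"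
    using t by (simp add: power_mult_distrib) (simp add: power2_eq_square field_simps)
  then show ?thesis
    using l1 Ru Rv by (simp add: rmf_surrogate_def rmf_objective_def distrib_left)
qed

text \<open>Comparing the minimizer with the zero step alone would lose the added penalty.
  Comparison with slightly shrunken steps keeps it, by strong convexity.\<close>

lemma rmf_surrogate_minimizer_decrease:
  assumes "convex Cu" "convex Cv" "convex_on UNIV Ru" "convex_on UNIV Rv"
    and "U \<in> Cu" "V \<in> Cv"
    and min: "is_arg_min (rmf_surrogate M W Ru Rv \<rho>u \<rho>v U V)
                (\<lambda>(A, B). U + A \<in> Cu \<and> V + B \<in> Cv) (DU, DV)"
  shows "rmf_surrogate M W Ru Rv \<rho>u \<rho>v U V (DU, DV) + \<rho>u / 2 * (norm DU)\<^sup>2 + \<rho>v / 2 * (norm DV)\<^sup>2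
    \<le> rmf_objective M W Ru Rv (U, V)"
proof -
  define G where "G = rmf_surrogate M W Ru Rv \<rho>u \<rho>v U V"
  define q where "q = \<rho>u / 2 * (norm DU)\<^sup>2 + \<rho>v / 2 * (norm DV)\<^sup>2"
  have min': "U + DU \<in> Cu" "V + DV \<in> Cv"
    "\<And>A B. U + A \<in> Cu \<Longrightarrow> V + B \<in> Cv \<Longrightarrow> G (DU, DV) \<le> G (A, B)"
    using min unfolding is_arg_min_def G_def by (auto simp: not_less)
  \<comment> \<open>Cancelling the common factor t leaves the penalty with weight 1 - t, which
    becomes the full penalty as t tends to 0.\<close>
  have *: "G (DU, DV) + (1 - t) * q \<le> rmf_objective M W Ru Rv (U, V)" if t: "0 < t" "t < 1" for t
  proof -
    have "U + (1 - t) *\<^sub>R DU = (1 - t) *\<^sub>R (U + DU) + t *\<^sub>R U"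
      "V + (1 - t) *\<^sub>R DV = (1 - t) *\<^sub>R (V + DV) + t *\<^sub>R V"
      by (simp_all add: algebra_simps)
    then have "U + (1 - t) *\<^sub>R DU \<in> Cu" "V + (1 - t) *\<^sub>R DV \<in> Cv"
      using t assms(1,2,5,6) min'(1,2) by (simp_all add: convexD)
    then have "G (DU, DV) \<le> G ((1 - t) *\<^sub>R DU, (1 - t) *\<^sub>R DV)"
      by (rule min'(3))
    also have "\<dots> \<le> (1 - t) * G (DU, DV) + t * rmf_objective M W Ru Rv (U, V) - t * (1 - t) * q"
      unfolding G_def q_def using assms(3,4) t by (intro rmf_surrogate_shrink) auto
    finally have "t * (G (DU, DV) + (1 - t) * q) \<le> t * rmf_objective M W Ru Rv (U, V)"
      by (simp add: algebra_simps)
    then show ?thesis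
      using t by simp
  qed
  have "((\<lambda>t. G (DU, DV) + (1 - t) * q) \<longlongrightarrow> G (DU, DV) + (1 - 0) * q) (at_right 0)"
    by (intro tendsto_intros)
  moreover have "\<forall>\<^sub>F t in at_right 0. G (DU, DV) + (1 - t) * q \<le> rmf_objective M W Ru Rv (U, V)"
    unfolding eventually_at_right_field using * by (intro exI [of _ 1]) auto
  ultimately show ?thesis
    unfolding G_def q_def by (auto dest!: tendsto_upperbound)
qed

section \<open>Passage to the limit and the stationarity criterion\<close>

lemma tendsto_rmf_objective:
  assumes "convex_on UNIV Ru" "convex_on UNIV Rv"
    and "(f \<longlongrightarrow> U) F" "(g \<longlongrightarrow> V) F"
  shows "((\<lambda>x. rmf_objective M W Ru Rv (f x, g x)) \<longlongrightarrow> rmf_objective M W Ru Rv (U, V)) F"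
proof -
  \<comment> \<open>A finite convex function on a finite-dimensional space is continuous.\<close>
  have "isCont Ru U" "isCont Rv V"
    using convex_on_continuous [OF open_UNIV assms(1)] convex_on_continuous [OF open_UNIV assms(2)]
    by (simp_all add: continuous_on_eq_continuous_at)
  then have "((\<lambda>x. Ru (f x)) \<longlongrightarrow> Ru U) F" "((\<lambda>x. Rv (g x)) \<longlongrightarrow> Rv V) F"
    using assms(3,4) by (auto intro: isCont_tendsto_compose)
  then show ?thesis
    unfolding rmf_objective_def prod.case
    by (intro tendsto_add tendsto_l1_norm tendsto_hadamard tendsto_mult tendsto_diff tendsto_const
        tendsto_matrix_mult_transpose assms(3,4))
qed

text \<open>Steps are parametrized by their target \<open>(P, Q)\<close>: it stays feasible while
  the centre moves, and the regularizers contribute the constants \<open>Ru P\<close> and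
  \<open>Rv Q\<close>.\<close>

lemma tendsto_rmf_surrogate:
  assumes "(f \<longlongrightarrow> U) F" "(g \<longlongrightarrow> V) F"
  shows "((\<lambda>x. rmf_surrogate M W Ru Rv \<rho>u \<rho>v (f x) (g x) (P - f x, Q - g x))
    \<longlongrightarrow> rmf_surrogate M W Ru Rv \<rho>u \<rho>v U V (P - U, Q - V)) F"
proof -
  have "((\<lambda>x. l1_norm (W \<odot> (M - f x ** transpose (g x) - (P - f x) ** transpose (g x)
          - f x ** transpose (Q - g x))) + Ru P + Rv Q
        + \<rho>u / 2 * (norm (P - f x))\<^sup>2 + \<rho>v / 2 * (norm (Q - g x))\<^sup>2)
    \<longlongrightarrow> l1_norm (W \<odot> (M - U ** transpose V - (P - U) ** transpose V
          - U ** transpose (Q - V))) + Ru P + Rv Q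
        + \<rho>u / 2 * (norm (P - U))\<^sup>2 + \<rho>v / 2 * (norm (Q - V))\<^sup>2) F"
    by (intro tendsto_add tendsto_l1_norm tendsto_hadamard tendsto_mult tendsto_diff tendsto_const tendsto_norm
        tendsto_power tendsto_matrix_mult_transpose assms)
  then show ?thesis
    by (simp add: rmf_surrogate_def)
qed

text \<open>The assumption \<open>min\<close> says that the zero step minimizes the surrogate
  centred at \<open>(U, V)\<close>. By the converse comparison the objective can then fall by at
  most a multiple of \<theta> squared along a feasible direction.\<close>

lemma stationary_point_over_if_surrogate_min:
  assumes "convex Cu" "convex Cv" "U \<in> Cu" "V \<in> Cv"
    and min: "\<And>P Q. P \<in> Cu \<Longrightarrow> Q \<in> Cv \<Longrightarrow>
      rmf_objective M W Ru Rv (U, V) \<le> rmf_surrogate M W Ru Rv \<rho>u \<rho>v U V (P - U, Q - V)"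
  shows "stationary_point_over (rmf_objective M W Ru Rv) (Cu \<times> Cv) (U, V)"
  unfolding stationary_point_over_def
proof (intro conjI allI impI)
  show "(U, V) \<in> Cu \<times> Cv"
    using assms(3,4) by simp
next
  fix d assume "(U, V) + d \<in> Cu \<times> Cv"
  moreover obtain A B where d: "d = (A, B)"
    by (cases d)
  ultimately have AB: "U + A \<in> Cu" "V + B \<in> Cv"
    by auto
  define F where "F = rmf_objective M W Ru Rv"
  define c where "c = l1_norm (W \<odot> (A ** transpose B)) + \<rho>u / 2 * (norm A)\<^sup>2 + \<rho>v / 2 * (norm B)\<^sup>2"
  have quot: "- (\<theta> * c) \<le> (F ((U, V) + \<theta> *\<^sub>R d) - F (U, V)) / \<theta>" if \<theta>: "0 < \<theta>" "\<theta> < 1" for \<theta>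
  proof -
    \<comment> \<open>Convexity makes the intermediate points feasible, so \<open>min\<close>
      applies to them.\<close>
    have "U + \<theta> *\<^sub>R A = (1 - \<theta>) *\<^sub>R U + \<theta> *\<^sub>R (U + A)" "V + \<theta> *\<^sub>R B = (1 - \<theta>) *\<^sub>R V + \<theta> *\<^sub>R (V + B)"
      by (simp_all add: algebra_simps)
    then have "U + \<theta> *\<^sub>R A \<in> Cu" "V + \<theta> *\<^sub>R B \<in> Cv"
      using \<theta> AB assms(1-4) by (simp_all add: convexD)
    from min [OF this]
    have "F (U, V) \<le> rmf_surrogate M W Ru Rv \<rho>u \<rho>v U V (\<theta> *\<^sub>R A, \<theta> *\<^sub>R B)"
      by (simp add: F_def)
    also have "\<dots> \<le> F (U + \<theta> *\<^sub>R A, V + \<theta> *\<^sub>R B) + (l1_norm (W \<odot> ((\<theta> *\<^sub>R A) ** transpose (\<theta> *\<^sub>R B)))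
        + \<rho>u / 2 * (norm (\<theta> *\<^sub>R A))\<^sup>2 + \<rho>v / 2 * (norm (\<theta> *\<^sub>R B))\<^sup>2)"
      unfolding F_def by (rule rmf_surrogate_le_objective)
    also have "W \<odot> ((\<theta> *\<^sub>R A) ** transpose (\<theta> *\<^sub>R B)) = (\<theta> * \<theta>) *\<^sub>R (W \<odot> (A ** transpose B))"
      by (simp add: matrix_scaleR_mult_transpose)
    finally have "F (U, V) \<le> F ((U, V) + \<theta> *\<^sub>R d) + \<theta> * \<theta> * c"
      by (simp add: c_def d l1_norm_scaleR power_mult_distrib power2_eq_square algebra_simps)
    then show ?thesis
      using \<theta> by (simp add: field_simps)
  qed
  have "((\<lambda>\<theta>. ereal (- (\<theta> * c))) \<longlongrightarrow> ereal (- (0 * c))) (at_right 0)"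
    by (intro tendsto_intros)
  \<comment> \<open>The lower bound of the quotients tends to 0, so \<open>Liminf_mono\<close>
    finishes the comparison.\<close>
  then have "0 = Liminf (at_right 0) (\<lambda>\<theta>. ereal (- (\<theta> * c)))"
    by (subst lim_imp_Liminf) (auto simp: zero_ereal_def)
  also have "\<dots> \<le> dir_deriv F (U, V) d"
    unfolding dir_deriv_def
    by (intro Liminf_mono) (use quot in \<open>auto simp: eventually_at_right_field intro!: exI [of _ 1]\<close>)
  finally show "0 \<le> dir_deriv (rmf_objective M W Ru Rv) (U, V) d"
    by (simp add: F_def)
qed

section \<open>Sufficient descent and stationarity of limit points\<close>

theorem theorem2:
  fixes M W :: "real^'n^'m"
    and Cu :: "(real^'r^'m) set" and Cv :: "(real^'r^'n) set"
    and Ru :: "real^'r^'m \<Rightarrow> real" and Rv :: "real^'r^'n \<Rightarrow> real"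
    and \<epsilon> :: real and \<rho>u \<rho>v :: "nat \<Rightarrow> real"
    and U DU :: "nat \<Rightarrow> real^'r^'m" and V DV :: "nat \<Rightarrow> real^'r^'n"
  assumes "\<And>i j. W $ i $ j \<in> {0, 1}"
    and "closed Cu" and "convex Cu" and "closed Cv" and "convex Cv"
    and "convex_on UNIV Ru" and "convex_on UNIV Rv"
    and "\<epsilon> > 0"
    and "\<And>k. \<rho>u k > 0" and "\<And>k. \<rho>v k > 0"
    and "rmf_iterates M W Ru Rv Cu Cv \<rho>u \<rho>v U V DU DV"
    and "gmmm_rule W \<epsilon> \<rho>u \<rho>v \<or> lmmm_rule M W Ru Rv \<epsilon> \<rho>u \<rho>v U V DU DV"
  shows "(\<exists>\<alpha>>0. \<forall>k.
            rmf_objective M W Ru Rv (U k, V k) - rmf_objective M W Ru Rv (U (Suc k), V (Suc k))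
              \<ge> \<alpha> * ((norm (U k - U (Suc k)))\<^sup>2 + (norm (V k - V (Suc k)))\<^sup>2))
       \<and> (\<forall>x. seq_limit_point (\<lambda>k. (U k, V k)) x
              \<longrightarrow> stationary_point_over (rmf_objective M W Ru Rv) (Cu \<times> Cv) x)"
proof -
  define F where "F = rmf_objective M W Ru Rv"
  define G where "G = (\<lambda>k. rmf_surrogate M W Ru Rv (\<rho>u k) (\<rho>v k) (U k) (V k))"
  have feasible: "U k \<in> Cu" "V k \<in> Cv"
    and min: "is_arg_min (rmf_surrogate M W Ru Rv (\<rho>u k) (\<rho>v k) (U k) (V k))
             (\<lambda>(A, B). U k + A \<in> Cu \<and> V k + B \<in> Cv) (DU k, DV k)"
    and step: "U (Suc k) = U k + DU k" "V (Suc k) = V k + DV k" for k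
    using assms(11) unfolding rmf_iterates_def by blast+
  have mono: "incseq \<rho>u" "incseq \<rho>v"
    using assms(12) by (auto simp: gmmm_rule_def lmmm_rule_def incseq_def)
  have ev: "\<forall>\<^sub>F k in sequentially. \<rho>u k = rho_bar_u W \<epsilon> \<and> \<rho>v k = rho_bar_v W \<epsilon>"
    using assms(12) by (auto simp: gmmm_rule_def lmmm_rule_def eventually_conj_iff)
  \<comment> \<open>The global rule gets this from the counting bound, the local rule from its line
    search condition.\<close>
  have major: "F (U (Suc k), V (Suc k)) \<le> G k (DU k, DV k)" for k
    using assms(12)
  proof
    assume "gmmm_rule W \<epsilon> \<rho>u \<rho>v"
    then show ?thesis
      using rmf_objective_le_surrogate [OF assms(1), of \<epsilon>] assms(8)
      by (simp add: F_def G_def step gmmm_rule_def)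
  qed (simp add: F_def G_def step lmmm_rule_def)
  \<comment> \<open>By monotonicity the parameters never fall below their initial values, so this
    constant serves every iteration.\<close>
  define \<alpha> where "\<alpha> = min (\<rho>u 0) (\<rho>v 0) / 2"
  have "\<alpha> > 0"
    using assms(9,10) by (simp add: \<alpha>_def)
  have descent: "\<alpha> * ((norm (U k - U (Suc k)))\<^sup>2 + (norm (V k - V (Suc k)))\<^sup>2)
      \<le> F (U k, V k) - F (U (Suc k), V (Suc k))" for k
  proof -
    have "\<rho>u 0 \<le> \<rho>u k" "\<rho>v 0 \<le> \<rho>v k"
      using mono by (auto simp: incseq_def)
    then have "\<alpha> * (norm (DU k))\<^sup>2 + \<alpha> * (norm (DV k))\<^sup>2
        \<le> \<rho>u k / 2 * (norm (DU k))\<^sup>2 + \<rho>v k / 2 * (norm (DV k))\<^sup>2"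
      by (intro add_mono mult_right_mono) (auto simp: \<alpha>_def)
    moreover have "G k (DU k, DV k) + \<rho>u k / 2 * (norm (DU k))\<^sup>2 + \<rho>v k / 2 * (norm (DV k))\<^sup>2
        \<le> F (U k, V k)"
      unfolding F_def G_def using assms(3,5,6,7) feasible min
      by (rule rmf_surrogate_minimizer_decrease)
    ultimately show ?thesis
      using major [of k] by (simp add: step distrib_left)
  qed
  have "F (U (Suc k), V (Suc k)) \<le> F (U k, V k)" for k
    using descent [of k] \<open>\<alpha> > 0\<close> by (smt (verit) mult_nonneg_nonneg zero_le_power2)
  then have decF: "decseq (\<lambda>k. F (U k, V k))"
    by (simp add: decseq_Suc_iff)
  have "stationary_point_over F (Cu \<times> Cv) x" if lim: "seq_limit_point (\<lambda>k. (U k, V k)) x" for x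
  proof -
    obtain X Y where x: "x = (X, Y)"
      by (cases x)
    from lim obtain s where s: "strict_mono s" and "((\<lambda>k. (U k, V k)) \<circ> s) \<longlonglongrightarrow> (X, Y)"
      unfolding seq_limit_point_def x by blast
    then have UX: "(\<lambda>k. U (s k)) \<longlonglongrightarrow> X" and VY: "(\<lambda>k. V (s k)) \<longlonglongrightarrow> Y"
      by (auto dest: tendsto_fst tendsto_snd simp: o_def)
    have XY: "X \<in> Cu" "Y \<in> Cv"
      using closed_sequentially [OF assms(2) _ UX] closed_sequentially [OF assms(4) _ VY] feasible
      by auto
    \<comment> \<open>The bound is the limit of the minimality of the steps at the indices
      \<open>s k\<close>. Since the parameters eventually equal their upper bounds, a single fixed
      surrogate appears in the limit.\<close>
    have "F (X, Y) \<le> rmf_surrogate M W Ru Rv (rho_bar_u W \<epsilon>) (rho_bar_v W \<epsilon>) X Y (P - X, Q - Y)"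
      if PQ: "P \<in> Cu" "Q \<in> Cv" for P Q
    proof (rule tendsto_le [OF sequentially_bot])
      show "(\<lambda>k. rmf_surrogate M W Ru Rv (rho_bar_u W \<epsilon>) (rho_bar_v W \<epsilon>) (U (s k)) (V (s k))
              (P - U (s k), Q - V (s k)))
          \<longlonglongrightarrow> rmf_surrogate M W Ru Rv (rho_bar_u W \<epsilon>) (rho_bar_v W \<epsilon>) X Y (P - X, Q - Y)"
        using UX VY by (rule tendsto_rmf_surrogate)
      \<comment> \<open>The index is \<open>s (Suc k)\<close> and not \<open>Suc (s k)\<close>:
        convergence is known only along \<open>s\<close>. Since
        \<open>Suc (s k) \<le> s (Suc k)\<close>, descent makes the objective at
        \<open>s (Suc k)\<close> no larger than just after step \<open>s k\<close>.\<close>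
      show "(\<lambda>k. F (U (s (Suc k)), V (s (Suc k)))) \<longlonglongrightarrow> F (X, Y)"
        unfolding F_def
        using assms(6,7) LIMSEQ_Suc [OF UX] LIMSEQ_Suc [OF VY] by (rule tendsto_rmf_objective)
      have "F (U (s (Suc k)), V (s (Suc k))) \<le> G (s k) (P - U (s k), Q - V (s k))" for k
      proof -
        have "Suc (s k) \<le> s (Suc k)"
          using s by (simp add: strict_mono_Suc_iff Suc_le_eq)
        then have "F (U (s (Suc k)), V (s (Suc k))) \<le> F (U (Suc (s k)), V (Suc (s k)))"
          using decF by (rule decseqD [rotated])
        also have "\<dots> \<le> G (s k) (DU (s k), DV (s k))"
          by (rule major)
        also have "\<dots> \<le> G (s k) (P - U (s k), Q - V (s k))"
          using min [of "s k"] PQ unfolding is_arg_min_def G_def by (auto simp: not_less)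
        finally show ?thesis .
      qed
      then show "\<forall>\<^sub>F k in sequentially. F (U (s (Suc k)), V (s (Suc k)))
          \<le> rmf_surrogate M W Ru Rv (rho_bar_u W \<epsilon>) (rho_bar_v W \<epsilon>) (U (s k)) (V (s k))
              (P - U (s k), Q - V (s k))"
        using eventually_subseq [OF s ev] unfolding G_def by (auto elim!: eventually_mono) metis
    qed
    then show ?thesis
      unfolding x F_def using assms(3,5) XY by (intro stationary_point_over_if_surrogate_min) auto
  qed
  with descent \<open>\<alpha> > 0\<close> show ?thesis
    unfolding F_def by blast
qed

end
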